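(* Let $m$ and $B$ be integers. If $2\le m-1\le B\le 3m-7$, and $d=2+\left\lfloor \frac{B-m}{2}\right\rfloor$, then $$h(m)\equiv \operatorname{odpr}(2^{m-1}+1,\,2^{m-1}+2^d-1)^{2^{m-1-d}}\pmod{2^B}.$$
   Context: $\operatorname{odpr}(\ell,n)$ denotes the product of all odd integers $j$ satisfying $\ell\le j\le n$, and $h(m)=\operatorname{odpr}(2^{m-1}+1,2^m-1)$.
   Formalization: The pair (m, B) = (3, 2) is excluded, since there d = 1 and the congruence fails: h(3) = 35 ≡ 3 while odpr(5,5)^2 = 25 ≡ 1 (mod 4); all other cases are as stated. *)

theory Defs
  imports Complex_Main "HOL-Number_Theory.Number_Theory"
begin

definition odpr :: "int \<Rightarrow> int \<Rightarrow> int" where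
  "odpr l n = (\<Prod>j | odd j \<and> l \<le> j \<and> j \<le> n. j)"

text \<open>Intended for positive arguments only: \<open>nat\<close> sends negative exponents to 0.\<close>

definition h :: "int \<Rightarrow> int" where
  "h m = odpr (2 ^ nat (m - 1) + 1) (2 ^ nat m - 1)"

text \<open>
  For \<open>m = 3\<close> and \<open>B = 2\<close>, which satisfy \<open>2 \<le> m - 1 \<le> B \<le> 3 * m - 7\<close> and give \<open>d = 1\<close>,
  the congruence \<open>h(m) = odpr(2^(m-1) + 1, 2^(m-1) + 2^d - 1)^(2^(m-1-d))\<close> modulo \<open>2^B\<close> fails:
  the two sides are 35 and 25, and the modulus is 4. This pair therefore has to be excluded.
\<close>

lemma odpr_congruence_fails_3_2:
  fixes m B d :: int
  assumes "m = 3" and "B = 2" and "d = 2 + \<lfloor>real_of_int (B - m) / 2\<rfloor>"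
  shows "\<not> [h m = odpr (2 ^ nat (m - 1) + 1) (2 ^ nat (m - 1) + 2 ^ nat d - 1)
                    ^ (2 ^ nat (m - 1 - d))] (mod (2 ^ nat B))"
proof -
  have d: "d = 1"
    using assms by (simp add: floor_eq_iff)
  have "{j::int. odd j \<and> 5 \<le> j \<and> j \<le> 7} = {5, 7}"
    by (auto; presburger)
  moreover have "{j::int. odd j \<and> 5 \<le> j \<and> j \<le> 5} = {5}"
    by auto
  ultimately have "odpr 5 7 = 35" and "odpr 5 5 = 5"
    by (simp_all add: odpr_def)
  then show ?thesis
    using assms(1,2) d by (simp add: h_def cong_def)
qed

end

theory Submission
  imports Defs "HOL-Computational_Algebra.Polynomial"
begin

text \<open>
  Let \<open>F\<^sub>d\<close> be the product of the polynomials \<open>X + i\<close> over the odd \<open>i < 2\<^sup>d\<close>. The symmetry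
  \<open>i \<mapsto> 2\<^sup>d - i\<close> makes \<open>F\<^sub>d\<close> a polynomial in \<open>X (X + 2\<^sup>d)\<close>, whose values at multiples of \<open>2\<^sup>d\<close>
  are divisible by \<open>2\<close> to the power \<open>2d + 1\<close>. The doubling \<open>F\<^sub>d\<^sub>+\<^sub>1 = F\<^sub>d * F\<^sub>d(X + 2\<^sup>d)\<close> yields
  by induction that \<open>2\<close> to the power \<open>d - 2\<close> divides the quadratic coefficient of \<open>F\<^sub>d\<close>. Hence,
  for \<open>d \<ge> 2\<close>, \<open>F\<^sub>d\<close> is constant on the multiples of \<open>2\<^sup>d\<close> modulo \<open>2\<close> to the power \<open>3d - 1\<close>, so
  that \<open>F\<^sub>d\<^sub>+\<^sub>1(x)\<close> is congruent to the square of \<open>F\<^sub>d(x)\<close> for this modulus. Each further squaring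
  gains a factor \<open>2\<close> in the modulus, and iterating from \<open>d\<close> up to \<open>m - 1\<close> gives the theorem
  unless \<open>d = 1\<close>, where \<open>B = m - 1\<close> and both sides are congruent to \<open>1\<close>.
\<close>

text \<open>The index is shifted: \<open>block_poly k\<close> is \<open>F\<^sub>k\<^sub>+\<^sub>1\<close>.\<close>

primrec block_poly :: "nat \<Rightarrow> int poly" where
  "block_poly 0 = [:1, 1:]"
| "block_poly (Suc k) = block_poly k * (block_poly k \<circ>\<^sub>p [:2 ^ Suc k, 1:])"

section \<open>Block polynomials as products of consecutive odd integers\<close>

lemma poly_block_poly_Suc:
  "poly (block_poly (Suc k)) x = poly (block_poly k) x * poly (block_poly k) (x + 2 ^ Suc k)"
  by (simp add: poly_pcompose add.commute)

lemma odpr_split: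
  assumes "l \<le> c" and "c \<le> n + 1"
  shows "odpr l n = odpr l (c - 1) * odpr c n"
proof -
  have fin: "finite {j::int. odd j \<and> a \<le> j \<and> j \<le> b}" for a b
    by (rule finite_subset[of _ "{a..b}"]) auto
  have "{j. odd j \<and> l \<le> j \<and> j \<le> n} =
      {j. odd j \<and> l \<le> j \<and> j \<le> c - 1} \<union> {j. odd j \<and> c \<le> j \<and> j \<le> n}"
    using assms by auto
  moreover have disjoint:
    "{j. odd j \<and> l \<le> j \<and> j \<le> c - 1} \<inter> {j. odd j \<and> c \<le> j \<and> j \<le> n} = {}"
    by auto
  ultimately show ?thesis
    unfolding odpr_def using prod.union_disjoint[OF fin fin disjoint, of "\<lambda>j. j"] by argo
qed

lemma odpr_drop_even:
  assumes "even l"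
  shows "odpr l n = odpr (l + 1) n"
proof -
  have "{j. odd j \<and> l \<le> j \<and> j \<le> n} = {j. odd j \<and> l + 1 \<le> j \<and> j \<le> n}"
    using assms by (auto simp: le_less)
  then show ?thesis
    by (simp add: odpr_def)
qed

lemma poly_block_poly_eq_odpr:
  assumes "even x"
  shows "poly (block_poly k) x = odpr (x + 1) (x + 2 ^ Suc k - 1)"
  using assms
proof (induction k arbitrary: x)
  case 0
  then have "{j. odd j \<and> x + 1 \<le> j \<and> j \<le> x + 1} = {x + 1}"
    by auto
  then show ?case
    by (simp add: odpr_def add.commute)
next
  case (Suc k)
  define t :: int where "t = 2 ^ Suc k"
  have t: "even t" "t \<ge> 1" "2 ^ Suc (Suc k) = 2 * t"
    unfolding t_def by (simp, rule one_le_power, simp_all)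
  \<comment> \<open>The cut is made at the even number \<open>x + t\<close>, so dropping it lets the
    right half begin at \<open>x + t + 1\<close>.\<close>
  have "odpr (x + 1) (x + 2 * t - 1) = odpr (x + 1) (x + t - 1) * odpr (x + t) (x + 2 * t - 1)"
    using t by (intro odpr_split) auto
  also have "odpr (x + t) (x + 2 * t - 1) = odpr (x + t + 1) (x + t + t - 1)"
    using odpr_drop_even[of "x + t"] t Suc.prems by (simp add: algebra_simps)
  finally show ?case
    using Suc.IH[of x] Suc.IH[of "x + t"] Suc.prems t
    unfolding poly_block_poly_Suc t(3) t_def[symmetric] by simp
qed

section \<open>Reflection symmetry and low-degree coefficients\<close>

text \<open>The reflection swaps the two factors of the doubling. With \<open>k \<ge> 1\<close> the
  degree \<open>2 ^ k\<close> is even, so the signs cancel.\<close>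

lemma poly_block_poly_reflect:
  assumes "k \<ge> 1"
  shows "poly (block_poly k) (- (2 ^ Suc k) - x) = poly (block_poly k) x"
  using assms
proof (induction k arbitrary: x rule: dec_induct)
  case base
  show ?case
    by (simp add: poly_pcompose algebra_simps)
next
  case (step k)
  have "poly (block_poly k) (- (2 ^ Suc (Suc k)) - x) = poly (block_poly k) (x + 2 ^ Suc k)"
  proof -
    have "- (2 ^ Suc (Suc k)) - x = - (2 ^ Suc k) - (x + 2 ^ Suc k)"
      by simp
    then show ?thesis
      using step.IH[of "x + 2 ^ Suc k"] by (simp only:)
  qed
  moreover have "poly (block_poly k) (- (2 ^ Suc (Suc k)) - x + 2 ^ Suc k) = poly (block_poly k) x"
    using step.IH[of x] by (simp add: algebra_simps)
  ultimately show ?case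
    unfolding poly_block_poly_Suc by simp
qed

lemma poly_quadratic_expansion:
  fixes p :: "'a::comm_ring_1 poly"
  shows "\<exists>r. \<forall>x. poly p x = coeff p 0 + coeff p 1 * x + coeff p 2 * x ^ 2 + x ^ 3 * poly r x"
proof -
  obtain a b c r where "p = pCons a (pCons b (pCons c r))"
    by (metis pCons_cases)
  then have "poly p x = coeff p 0 + coeff p 1 * x + coeff p 2 * x ^ 2 + x ^ 3 * poly r x" for x
    by (simp add: algebra_simps power2_eq_square power3_eq_cube numeral_2_eq_2)
  then show ?thesis
    by blast
qed

text \<open>Modulo \<open>c\<close> the shift is the identity, so a doubled block polynomial is a
  square up to a multiple of \<open>2 ^ Suc k\<close>.\<close>

lemma pcompose_shift_eq:
  fixes p :: "'a::comm_ring_1 poly"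
  obtains r where "p \<circ>\<^sub>p [:c, 1:] = p + smult c r"
proof -
  have "\<exists>r. p \<circ>\<^sub>p [:c, 1:] = p + smult c r"
  proof (induction p)
    case 0
    then show ?case
      by (auto intro: exI[of _ 0])
  next
    case (pCons a p)
    then obtain r where r: "p \<circ>\<^sub>p [:c, 1:] = p + smult c r"
      by blast
    have "pCons a p \<circ>\<^sub>p [:c, 1:] = pCons a p + smult c (p + smult c r + pCons 0 r)"
      by (simp add: pcompose_pCons r algebra_simps smult_add_right)
    then show ?case
      by blast
  qed
  then show ?thesis
    using that by blast
qed

text \<open>By reflection the values at \<open>0\<close> and \<open>- (2 ^ Suc k)\<close> agree; the
  difference of their expansions is then divided by \<open>2 ^ Suc k\<close>.\<close>

lemma block_poly_linear_coeff:
  assumes "k \<ge> 1"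
  shows "[coeff (block_poly k) 1 = coeff (block_poly k) 2 * 2 ^ Suc k] (mod 2 ^ (2 * Suc k))"
proof -
  define t :: int where "t = 2 ^ Suc k"
  obtain r where r: "\<And>x. poly (block_poly k) x = coeff (block_poly k) 0 +
      coeff (block_poly k) 1 * x + coeff (block_poly k) 2 * x ^ 2 + x ^ 3 * poly r x"
    using poly_quadratic_expansion by blast
  have "poly (block_poly k) (- t) = poly (block_poly k) 0"
    using poly_block_poly_reflect[OF assms, of 0] by (simp add: t_def)
  then have "t * (coeff (block_poly k) 1 - coeff (block_poly k) 2 * t) = t * (t ^ 2 * - poly r (- t))"
    unfolding r by (simp add: algebra_simps power2_eq_square power3_eq_cube)
  moreover have "t \<noteq> 0"
    by (simp add: t_def)
  ultimately have "coeff (block_poly k) 1 - coeff (block_poly k) 2 * t = t ^ 2 * - poly r (- t)"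
    by (simp only: mult_cancel_left) simp
  moreover have "t ^ 2 = 2 ^ (2 * Suc k)"
    by (simp only: t_def power_mult[symmetric] mult.commute)
  ultimately show ?thesis
    unfolding cong_iff_dvd_diff t_def by (metis dvd_triv_left)
qed

lemma block_poly_quadratic_coeff:
  assumes "k \<ge> 1"
  shows "2 ^ (k - 1) dvd coeff (block_poly k) 2"
  using assms
proof (induction k rule: dec_induct)
  case base
  show ?case
    by simp
next
  case (step k)
  define p where "p = block_poly k"
  obtain r where r: "p \<circ>\<^sub>p [:2 ^ Suc k, 1:] = p + smult (2 ^ Suc k) r"
    by (rule pcompose_shift_eq)
  have "block_poly (Suc k) = p * p + smult (2 ^ Suc k) (p * r)"
    by (simp only: block_poly.simps p_def[symmetric] r) (simp add: algebra_simps)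
  \<comment> \<open>The two equal cross terms of \<open>p * p\<close> supply the new factor
    2.\<close>
  then have "coeff (block_poly (Suc k)) 2 =
      2 * coeff p 2 * coeff p 0 + coeff p 1 * coeff p 1 + 2 ^ Suc k * coeff (p * r) 2"
    by (simp add: coeff_mult numeral_2_eq_2)
  moreover have "2 ^ k dvd 2 * coeff p 2"
    using mult_dvd_mono[OF dvd_refl[of 2] step.IH] step.hyps
    by (simp add: p_def power_Suc[symmetric] del: power_Suc)
  moreover have "2 ^ k dvd coeff p 1"
  proof -
    have "[coeff p 1 = coeff p 2 * 2 ^ Suc k] (mod 2 ^ k)"
      unfolding p_def
      by (rule cong_dvd_modulus[OF block_poly_linear_coeff[OF step.hyps(1)]])
        (intro le_imp_power_dvd, simp)
    then show ?thesis
      by (simp add: cong_dvd_iff)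
  qed
  moreover have "(2::int) ^ k dvd 2 ^ Suc k"
    by (intro le_imp_power_dvd) simp
  ultimately show ?case
    by (simp del: power_Suc)
qed

section \<open>Doubling as squaring modulo powers of 2\<close>

lemma poly_block_poly_cong_coeff_0:
  assumes "k \<ge> 1" and "2 ^ Suc k dvd x"
  shows "[poly (block_poly k) x = coeff (block_poly k) 0] (mod 2 ^ (3 * k + 2))"
proof -
  define t :: int where "t = 2 ^ Suc k"
  define a b where "a = coeff (block_poly k) 1" and "b = coeff (block_poly k) 2"
  obtain y where y: "x = t * y"
    using assms(2) by (auto simp: t_def)
  obtain r where r: "\<And>x. poly (block_poly k) x = coeff (block_poly k) 0 +
      a * x + b * x ^ 2 + x ^ 3 * poly r x"
    unfolding a_def b_def using poly_quadratic_expansion by blast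
  have t2: "t ^ 2 = 2 ^ (2 * Suc k)" and t3: "t ^ 3 = 2 ^ (3 * Suc k)"
    by (simp_all only: t_def power_mult[symmetric] mult.commute)
  have "t ^ 2 dvd a - b * t"
    using block_poly_linear_coeff[OF assms(1)]
    by (simp only: cong_iff_dvd_diff t2 a_def b_def) (simp only: t_def)
  then obtain s where "a - b * t = t ^ 2 * s" ..
  then have s: "a = b * t + t ^ 2 * s"
    by (simp only: diff_eq_eq add.commute)
  \<comment> \<open>Substituting for \<open>a\<close> merges the linear and quadratic terms; the
    product \<open>y * (y + 1)\<close> of consecutive integers is even, which gives the last factor
    2.\<close>
  have "poly (block_poly k) x - coeff (block_poly k) 0 =
      b * t ^ 2 * (y * (y + 1)) + t ^ 3 * (s * y + y ^ 3 * poly r x)"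
    unfolding r y s by (simp add: algebra_simps power2_eq_square power3_eq_cube)
  moreover have "2 ^ (3 * k + 2) dvd b * t ^ 2 * (y * (y + 1))"
  proof -
    have "2 ^ (k - 1) * 2 ^ (2 * Suc k) * 2 dvd b * t ^ 2 * (y * (y + 1))"
      using block_poly_quadratic_coeff[OF assms(1)]
      unfolding t2 b_def by (intro mult_dvd_mono) auto
    moreover have "(2::int) ^ (k - 1) * 2 ^ (2 * Suc k) * 2 = 2 ^ ((k - 1) + 2 * Suc k + 1)"
      by (simp only: power_add power_one_right)
    moreover have "(k - 1) + 2 * Suc k + 1 = 3 * k + 2"
      using assms(1) by simp
    ultimately show ?thesis
      by (simp only:)
  qed
  moreover have "2 ^ (3 * k + 2) dvd t ^ 3 * (s * y + y ^ 3 * poly r x)"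
    unfolding t3 by (intro dvd_mult2 le_imp_power_dvd) simp
  ultimately show ?thesis
    unfolding cong_iff_dvd_diff by simp
qed

lemma poly_block_poly_Suc_cong_square:
  assumes "k \<ge> 1" and "2 ^ Suc k dvd x"
  shows "[poly (block_poly (Suc k)) x = poly (block_poly k) x ^ 2] (mod 2 ^ (3 * k + 2))"
proof -
  have "[poly (block_poly k) (x + 2 ^ Suc k) = coeff (block_poly k) 0] (mod 2 ^ (3 * k + 2))"
    using assms by (intro poly_block_poly_cong_coeff_0) (simp_all del: power_Suc)
  then have "[poly (block_poly k) (x + 2 ^ Suc k) = poly (block_poly k) x] (mod 2 ^ (3 * k + 2))"
    using poly_block_poly_cong_coeff_0[OF assms] by (meson cong_sym cong_trans)
  then show ?thesis
    unfolding poly_block_poly_Suc power2_eq_square by (rule cong_scalar_left)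
qed

text \<open>In \<open>(a + b) * (a - b)\<close> the first factor is even, as
  \<open>n \<ge> 1\<close> gives \<open>a\<close> and \<open>b\<close> the same parity.\<close>

lemma cong_square_lift:
  fixes a b :: int
  assumes "[a = b] (mod 2 ^ n)" and "n \<ge> 1"
  shows "[a ^ 2 = b ^ 2] (mod 2 ^ Suc n)"
proof -
  have n: "2 ^ n dvd a - b"
    using assms(1) by (simp add: cong_iff_dvd_diff)
  moreover have "(2::int) dvd 2 ^ n"
    using assms(2) by simp
  ultimately have "even (a - b)"
    by (rule dvd_trans[rotated])
  then have "2 dvd a + b"
    by simp
  then have "2 * 2 ^ n dvd (a + b) * (a - b)"
    using n by (rule mult_dvd_mono)
  then show ?thesis
    by (simp add: cong_iff_dvd_diff power2_eq_square algebra_simps)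
qed

lemma cong_power2_lift:
  fixes a b :: int
  assumes "[a = b] (mod 2 ^ n)" and "n \<ge> 1"
  shows "[a ^ 2 ^ j = b ^ 2 ^ j] (mod 2 ^ (n + j))"
proof (induction j)
  case 0
  then show ?case
    using assms by simp
next
  case (Suc j)
  then show ?case
    using cong_square_lift[OF Suc] assms(2) by (simp add: power_mult[symmetric] mult.commute)
qed

text \<open>The exponent starts at \<open>3 * k + 1\<close> so that \<open>j = 1\<close> meets the
  \<open>3 * k + 2\<close> of the first doubling. Later doublings are more precise, and squaring
  adds one each time.\<close>

lemma poly_block_poly_cong_power:
  assumes "k \<ge> 1" and "2 ^ (k + j) dvd x"
  shows "[poly (block_poly (k + j)) x = poly (block_poly k) x ^ 2 ^ j] (mod 2 ^ (3 * k + 1 + j))"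
  using assms(2)
proof (induction j)
  case 0
  then show ?case
    by simp
next
  case (Suc j)
  have "2 ^ (k + j) dvd x"
    using Suc.prems by (rule dvd_trans[rotated]) (simp add: le_imp_power_dvd)
  note IH = Suc.IH[OF this]
  have "[poly (block_poly (Suc (k + j))) x = poly (block_poly (k + j)) x ^ 2]
      (mod 2 ^ (3 * (k + j) + 2))"
    using assms(1) Suc.prems by (intro poly_block_poly_Suc_cong_square) simp_all
  then have "[poly (block_poly (Suc (k + j))) x = poly (block_poly (k + j)) x ^ 2]
      (mod 2 ^ Suc (3 * k + 1 + j))"
    by (rule cong_dvd_modulus) (intro le_imp_power_dvd, simp)
  moreover have "[poly (block_poly (k + j)) x ^ 2 = (poly (block_poly k) x ^ 2 ^ j) ^ 2]
      (mod 2 ^ Suc (3 * k + 1 + j))"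
    by (intro cong_square_lift IH) simp
  ultimately have "[poly (block_poly (Suc (k + j))) x = (poly (block_poly k) x ^ 2 ^ j) ^ 2]
      (mod 2 ^ Suc (3 * k + 1 + j))"
    by (rule cong_trans)
  then show ?case
    by (simp add: power_mult[symmetric] mult.commute)
qed

text \<open>This serves the case \<open>d = 1\<close>. Squaring starts from index 1, where the value
  is 3 modulo 8 because \<open>n \<ge> 2\<close>, and its square is 1 modulo 8.\<close>

lemma poly_block_poly_cong_1:
  assumes "n \<ge> 2"
  shows "[poly (block_poly n) (2 ^ Suc n) = 1] (mod 2 ^ Suc n)"
proof -
  obtain i where i: "n = Suc (Suc i)"
    using assms by (metis add_2_eq_Suc le_Suc_ex)
  define x :: int where "x = 2 ^ Suc n"
  have "poly (block_poly 1) x = x * (x + 4) + 3"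
    by (simp add: poly_pcompose algebra_simps)
  moreover have "8 dvd x"
    by (simp add: x_def i)
  ultimately have "[poly (block_poly 1) x = 3] (mod 8)"
    by (simp add: cong_iff_dvd_diff)
  then have "[poly (block_poly 1) x ^ 2 = 3 ^ 2] (mod 8)"
    by (rule cong_pow)
  then have "[poly (block_poly 1) x ^ 2 = 1] (mod 2 ^ 3)"
    unfolding cong_def by simp
  then have "[(poly (block_poly 1) x ^ 2) ^ 2 ^ i = 1 ^ 2 ^ i] (mod 2 ^ (3 + i))"
    by (rule cong_power2_lift) simp
  then have "[poly (block_poly 1) x ^ 2 ^ Suc i = 1] (mod 2 ^ Suc n)"
    by (simp add: power_mult[symmetric] i power_add)
  moreover have "[poly (block_poly (1 + Suc i)) x = poly (block_poly 1) x ^ 2 ^ Suc i]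
      (mod 2 ^ (3 * 1 + 1 + Suc i))"
    by (rule poly_block_poly_cong_power) (simp_all add: x_def i)
  then have "[poly (block_poly (1 + Suc i)) x = poly (block_poly 1) x ^ 2 ^ Suc i] (mod 2 ^ Suc n)"
    by (rule cong_dvd_modulus) (intro le_imp_power_dvd, simp add: i)
  ultimately have "[poly (block_poly (1 + Suc i)) x = 1] (mod 2 ^ Suc n)"
    by (rule cong_trans[rotated])
  then show ?thesis
    by (simp only: x_def i plus_1_eq_Suc)
qed

theorem theorem1p4:
  fixes m B d :: int
  assumes "2 \<le> m - 1" and "m - 1 \<le> B" and "B \<le> 3 * m - 7"
    and "(m, B) \<noteq> (3, 2)"
    and "d = 2 + \<lfloor>real_of_int (B - m) / 2\<rfloor>"
  shows "[h m = odpr (2 ^ nat (m - 1) + 1) (2 ^ nat (m - 1) + 2 ^ nat d - 1)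
                  ^ (2 ^ nat (m - 1 - d))] (mod (2 ^ nat B))"
proof -
  have d: "d = 2 + (B - m) div 2"
    using assms(5) floor_divide_of_int_eq[of "B - m" 2, where 'a = real] by simp
  define n where "n = nat (m - 2)"
  define k where "k = nat (d - 1)"
  define x :: int where "x = 2 ^ Suc n"
  have m: "m = int n + 2" and n: "n \<ge> 1"
    using assms(1) by (simp_all add: n_def)
  \<comment> \<open>The bounds on \<open>B\<close> give \<open>1 \<le> d\<close> and
    \<open>d \<le> m - 2\<close>, so \<open>nat\<close> truncates nothing.\<close>
  have dk: "d = int k + 1" and kn: "k \<le> n"
    using assms(2,3) d m unfolding k_def by auto
  have exps: "nat (m - 1) = Suc n" "nat m = Suc (Suc n)" "nat d = Suc k" "nat (m - 1 - d) = n - k"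
    using m dk by auto
  have x: "even x"
    by (simp add: x_def)
  have h: "h m = poly (block_poly n) x"
    using poly_block_poly_eq_odpr[OF x, of n] by (simp add: h_def exps x_def)
  have rhs: "odpr (2 ^ nat (m - 1) + 1) (2 ^ nat (m - 1) + 2 ^ nat d - 1) = poly (block_poly k) x"
    using poly_block_poly_eq_odpr[OF x, of k] by (simp add: exps x_def)
  show ?thesis
  proof (cases "k = 0")
    case True
    \<comment> \<open>Here \<open>(B - m) div 2 = - 1\<close>, so \<open>m - 1 \<le> B\<close>
      forces \<open>B = m - 1\<close>. The excluded pair is then the case
      \<open>n = 1\<close>.\<close>
    then have B: "nat B = Suc n"
      using d dk m assms(2) by auto
    then have "n \<ge> 2"
      using assms(4) m n by auto
    then have "[h m = 1] (mod 2 ^ Suc n)"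
      unfolding h x_def by (rule poly_block_poly_cong_1)
    moreover have "[poly (block_poly k) x = 1] (mod 2 ^ Suc n)"
      using True by (simp add: cong_iff_dvd_diff x_def)
    then have "[poly (block_poly k) x ^ 2 ^ (n - k) = 1] (mod 2 ^ Suc n)"
      using cong_pow by fastforce
    ultimately show ?thesis
      unfolding rhs unfolding exps B by (rule cong_trans[OF _ cong_sym])
  next
    case False
    have "[poly (block_poly (k + (n - k))) x = poly (block_poly k) x ^ 2 ^ (n - k)]
        (mod 2 ^ (3 * k + 1 + (n - k)))"
      using False kn by (intro poly_block_poly_cong_power) (simp_all add: x_def)
    \<comment> \<open>From \<open>(B - m) div 2 = k - 1\<close> follows
      \<open>B - m \<le> 2 * k - 1\<close>, with equality for odd \<open>B - m\<close>.\<close>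
    moreover have "nat B \<le> 3 * k + 1 + (n - k)"
      using d dk m kn by auto
    ultimately show ?thesis
      unfolding h rhs unfolding exps using kn
      by (metis cong_dvd_modulus le_add_diff_inverse le_imp_power_dvd)
  qed
qed

end
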